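(* For all integers $L\geq 1$ and $n\geq 0$, $$ \sum_{m\geq 0}\binom{m}{2}\,a_2\!\left(\left\lceil\frac{L}{2}\right\rceil,m,n\right)\ \geq\ \sum_{m\geq 0}\binom{m}{2}\,b_2(L,m,n). $$
   Context: The hook length of a cell in the Young diagram of a partition is one plus the number of cells to its right in the same row plus the number of cells below it in the same column. A hook of length two means a cell whose hook length equals $2$. For integers $L\ge 1$ and $m,n\ge 0$: $a_2(L,m,n)$ is the number of partitions of $n$ into odd parts (repetitions allowed), each at most $2L-1$, having exactly $m$ hooks of length two; $b_2(L,m,n)$ is the number of partitions of $n$ into distinct parts, each at most $L$, having exactly $m$ hooks of length two. *)

theory Defs
  imports Complex_Main
begin

definition partitions :: "nat \<Rightarrow> nat list set" where
  "partitions n = {p. sorted_wrt (\<ge>) p \<and> 0 \<notin> set p \<and> sum_list p = n}"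

(* Rows and columns are numbered from 0, row 0 being the largest part. *)
definition young_diagram :: "nat list \<Rightarrow> (nat \<times> nat) set" where
  "young_diagram p = {(i, j). i < length p \<and> j < p ! i}"

definition hook_length :: "nat list \<Rightarrow> nat \<times> nat \<Rightarrow> nat" where
  "hook_length p c = (case c of (i, j) \<Rightarrow>
     1 + card {j'. j < j' \<and> (i, j') \<in> young_diagram p}
       + card {i'. i < i' \<and> (i', j) \<in> young_diagram p})"

definition num_hooks :: "nat \<Rightarrow> nat list \<Rightarrow> nat" where
  "num_hooks k p = card {c \<in> young_diagram p. hook_length p c = k}"

definition a\<^sub>2 :: "nat \<Rightarrow> nat \<Rightarrow> nat \<Rightarrow> nat" where
  "a\<^sub>2 L m n = card {p \<in> partitions n.
     (\<forall>x\<in>set p. odd x \<and> x \<le> 2 * L - 1) \<and> num_hooks 2 p = m}"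

definition b\<^sub>2 :: "nat \<Rightarrow> nat \<Rightarrow> nat \<Rightarrow> nat" where
  "b\<^sub>2 L m n = card {p \<in> partitions n.
     distinct p \<and> (\<forall>x\<in>set p. x \<le> L) \<and> num_hooks 2 p = m}"

(* The facts below show that the sets counted above are finite and that the sums over
   all m have finite support, so that neither card nor suminf takes a junk value. *)

lemma finite_partitions: "finite (partitions n)"
proof -
  have len: "length p \<le> sum_list p" if "0 \<notin> set p" for p :: "nat list"
    using that by (induction p) auto
  have "set p \<subseteq> {..n} \<and> length p \<le> n" if "p \<in> partitions n" for p
    using that len[of p] member_le_sum_list[of _ p] by (simp add: partitions_def subset_eq)
  then have "partitions n \<subseteq> {p. set p \<subseteq> {..n} \<and> length p \<le> n}"
    by blast
  then show ?thesis
    by (rule finite_subset) (rule finite_lists_length_le, simp)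
qed

lemma card_young_diagram: "finite (young_diagram p) \<and> card (young_diagram p) = sum_list p"
proof -
  have eq: "young_diagram p = Sigma {..<length p} (\<lambda>i. {..<p ! i})"
    by (auto simp: young_diagram_def)
  show ?thesis
    unfolding eq by (simp add: sum_list_sum_nth atLeast0LessThan)
qed

lemma num_hooks_le: "num_hooks k p \<le> sum_list p"
proof -
  have "num_hooks k p \<le> card (young_diagram p)"
    unfolding num_hooks_def by (rule card_mono) (auto simp: card_young_diagram)
  then show ?thesis by (simp add: card_young_diagram)
qed

lemma num_hooks_partition: "num_hooks k p \<le> n" if "p \<in> partitions n"
  using num_hooks_le[of k p] that by (simp add: partitions_def)

lemma a\<^sub>2_eq_0: "a\<^sub>2 L m n = 0" if "m > n"
proof -
  have ne: "num_hooks 2 p \<noteq> m" if "p \<in> partitions n" for p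
    using num_hooks_partition[OF that, of 2] \<open>m > n\<close> by simp
  have "{p \<in> partitions n. (\<forall>x\<in>set p. odd x \<and> x \<le> 2 * L - 1) \<and> num_hooks 2 p = m} = {}"
    using ne by blast
  then show ?thesis by (simp only: a\<^sub>2_def card.empty)
qed

lemma b\<^sub>2_eq_0: "b\<^sub>2 L m n = 0" if "m > n"
proof -
  have ne: "num_hooks 2 p \<noteq> m" if "p \<in> partitions n" for p
    using num_hooks_partition[OF that, of 2] \<open>m > n\<close> by simp
  have "{p \<in> partitions n. distinct p \<and> (\<forall>x\<in>set p. x \<le> L) \<and> num_hooks 2 p = m} = {}"
    using ne by blast
  then show ?thesis by (simp only: b\<^sub>2_def card.empty)
qed

lemma suminf_a\<^sub>2: "(\<Sum>m. (m choose 2) * a\<^sub>2 L m n) = (\<Sum>m\<le>n. (m choose 2) * a\<^sub>2 L m n)"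
  by (rule suminf_finite) (auto simp: a\<^sub>2_eq_0)

lemma suminf_b\<^sub>2: "(\<Sum>m. (m choose 2) * b\<^sub>2 L m n) = (\<Sum>m\<le>n. (m choose 2) * b\<^sub>2 L m n)"
  by (rule suminf_finite) (auto simp: b\<^sub>2_eq_0)

end

theory Submission
  imports Defs "HOL-Library.Multiset" "HOL-Computational_Algebra.Formal_Power_Series"
begin

unbundle fps_syntax

text \<open>
  Since \<open>b\<^sub>2\<close> counts more partitions when \<open>L\<close> grows, let \<open>L = 2 M\<close>, and put \<open>N = M - 2\<close>,
  \<open>y = q^2\<close> and \<open>D\<close> = the product of \<open>1 + q^i\<close> over \<open>i \<le> 2 N\<close>. A recurrence in \<open>L\<close> for the binomial
  moments of the number of hooks evaluates the generating function on the right in closed form,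
  as \<open>D\<close> times the sum of \<open>y^(3 + 2 i + j)\<close> over \<open>i \<le> N\<close>, \<open>j \<le> 2 N\<close>.
  On the left it suffices to count the pairs of (equal or different) odd parts
  \<open>2 a + 3 \<le> 2 b + 3\<close>, which gives the generating function of all odd partitions times the sum \<open>V\<close> of
  \<open>y^(3 + a + b)\<close> over \<open>a \<le> b \<le> N\<close>. By a finite form of Euler's identity the odd partitions dominate
  \<open>D (1 + K)\<close>, where \<open>K\<close> is the sum of \<open>y^k\<close> over \<open>N < k \<le> 2 N + 1\<close>.
  A pair \<open>(i, j)\<close> with \<open>i + j \<le> N\<close> is then matched with \<open>(a, b) = (i, i + j)\<close> in \<open>V\<close>, and any other pair with
  \<open>a + b = i + j - N - 1\<close> and \<open>k = N + 1 + i\<close> in \<open>V K\<close>.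
\<close>

section \<open>Hooks of length two\<close>

text \<open>A hook of length two either has arm 1 and lies in the last row of a part \<open>x \<ge> 2\<close> such that
  \<open>x - 1\<close> is not a part, or has leg 1 and ends the last row but one of a repeated part.\<close>

definition gap_parts :: "nat set \<Rightarrow> nat set" where
  "gap_parts S = {x \<in> S. 2 \<le> x \<and> x - 1 \<notin> S}"

definition repeated_parts :: "nat multiset \<Rightarrow> nat set" where
  "repeated_parts P = {x. 2 \<le> count P x}"

lemma finite_gap_parts [simp]: "finite S \<Longrightarrow> finite (gap_parts S)"
  by (simp add: gap_parts_def)

lemma repeated_parts_subset: "repeated_parts P \<subseteq> set_mset P"
  by (auto simp: repeated_parts_def simp flip: count_greater_zero_iff)

lemma finite_repeated_parts [simp]: "finite (repeated_parts P)"
  by (rule finite_subset[OF repeated_parts_subset]) simp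

lemma hook_length_Cons_Suc: "hook_length (a # p) (Suc i, j) = hook_length p (i, j)"
proof -
  have arm: "{j'. j < j' \<and> (Suc i, j') \<in> young_diagram (a # p)} = {j'. j < j' \<and> (i, j') \<in> young_diagram p}"
    by (auto simp: young_diagram_def)
  have leg: "{i'. Suc i < i' \<and> (i', j) \<in> young_diagram (a # p)}
      = Suc ` {i'. i < i' \<and> (i', j) \<in> young_diagram p}"
    by (force simp: young_diagram_def image_iff less_Suc_eq_0_disj gr0_conv_Suc Suc_less_eq2)
  show ?thesis
    by (simp add: hook_length_def arm leg card_image)
qed

lemma hook_length_Cons_0:
  "hook_length (a # p) (0, j) = 1 + (a - 1 - j) + length (filter (\<lambda>x. j < x) p)"
proof -
  have "{j'. j < j' \<and> (0, j') \<in> young_diagram (a # p)} = {j<..<a}"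
    by (auto simp: young_diagram_def)
  moreover have "{i'. 0 < i' \<and> (i', j) \<in> young_diagram (a # p)} = Suc ` {i. i < length p \<and> j < p ! i}"
    by (force simp: young_diagram_def image_iff less_Suc_eq_0_disj gr0_conv_Suc)
  ultimately show ?thesis
    by (simp add: hook_length_def card_image length_filter_conv_card)
qed

text \<open>The last cell of the row has arm 0, so it needs leg 1, that is, exactly one further copy
  of \<open>a\<close>. The cell before it has arm 1, so it needs leg 0, which excludes parts
  \<open>a\<close> and \<open>a - 1\<close> below. Every other cell has arm at least 2.\<close>

lemma top_row_hooks:
  assumes "\<forall>x\<in>set p. x \<le> a" "0 < a"
  shows "card {j. j < a \<and> hook_length (a # p) (0, j) = 2} =
    (if count (mset p) a = 1 then 1 else 0) + (if 2 \<le> a \<and> a \<notin> set p \<and> a - 1 \<notin> set p then 1 else 0)"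
proof -
  let ?U = "{j. j = a - 1 \<and> count (mset p) a = 1}"
  let ?V = "{j. j = a - 2 \<and> 2 \<le> a \<and> a \<notin> set p \<and> a - 1 \<notin> set p}"
  have last: "filter (\<lambda>x. a - Suc 0 < x) p = filter (\<lambda>x. a = x) p"
    using assms by (intro filter_cong) auto
  have cnt: "length (filter (\<lambda>x. a = x) p) = count (mset p) a"
    by (simp add: count_mset count_list_eq_length_filter)
  have prev: "filter (\<lambda>x. a - 2 < x) p = [] \<longleftrightarrow> a \<notin> set p \<and> a - 1 \<notin> set p" if "2 \<le> a"
  proof -
    have "x \<le> a - 2 \<longleftrightarrow> x \<noteq> a \<and> x \<noteq> a - 1" if "x \<in> set p" for x
      using assms that \<open>2 \<le> a\<close> by force
    then show ?thesis
      by (auto simp: filter_empty_conv not_less)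
  qed
  have "j < a \<and> hook_length (a # p) (0, j) = 2 \<longleftrightarrow> j \<in> ?U \<union> ?V" for j
  proof -
    consider "a \<le> j" | "j = a - 1" | "2 \<le> a" "j = a - 2" | "j + 3 \<le> a" by linarith
    then show ?thesis
    proof cases
      case 1
      then show ?thesis using assms by auto
    next
      case 2
      then show ?thesis using assms by (auto simp: hook_length_Cons_0 last cnt)
    next
      case 3
      then show ?thesis using prev by (auto simp: hook_length_Cons_0)
    next
      case 4
      then show ?thesis by (auto simp: hook_length_Cons_0)
    qed
  qed
  then have "{j. j < a \<and> hook_length (a # p) (0, j) = 2} = ?U \<union> ?V" by blast
  moreover have "card (?U \<union> ?V) = card ?U + card ?V"
    using assms by (intro card_Un_disjoint) auto
  ultimately show ?thesis by simp
qed

text \<open>Induction adding the largest part as a new top row: hooks of the lower rows are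
  unchanged, and the hooks of the new row match the growth of the two sets.\<close>

lemma num_hooks_2:
  assumes "sorted_wrt (\<ge>) p" "0 \<notin> set p"
  shows "num_hooks 2 p = card (gap_parts (set p)) + card (repeated_parts (mset p))"
  using assms
proof (induction p)
  case Nil
  then show ?case by (simp add: num_hooks_def young_diagram_def gap_parts_def repeated_parts_def)
next
  case (Cons a p)
  have le: "\<forall>x\<in>set p. x \<le> a" and pos: "0 < a" using Cons.prems by auto
  let ?top = "{j. j < a \<and> hook_length (a # p) (0, j) = 2}"
  let ?rest = "{c \<in> young_diagram p. hook_length p c = 2}"
  have "c \<in> young_diagram (a # p) \<and> hook_length (a # p) c = 2 \<longleftrightarrow>
      c \<in> Pair 0 ` ?top \<union> map_prod Suc id ` ?rest" for c
  proof (cases c)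
    case (Pair i j)
    then show ?thesis
      by (cases i) (auto simp: hook_length_Cons_Suc young_diagram_def image_iff)
  qed
  then have split: "{c \<in> young_diagram (a # p). hook_length (a # p) c = 2}
      = Pair 0 ` ?top \<union> map_prod Suc id ` ?rest"
    by blast
  have "finite ?rest" using card_young_diagram[of p] by simp
  then have "num_hooks 2 (a # p) = card (Pair (0::nat) ` ?top) + card (map_prod Suc (id :: nat \<Rightarrow> nat) ` ?rest)"
    unfolding num_hooks_def split by (intro card_Un_disjoint) auto
  also have "card (Pair (0::nat) ` ?top) = card ?top"
    by (simp add: card_image inj_on_def)
  also have "card (map_prod Suc (id :: nat \<Rightarrow> nat) ` ?rest) = num_hooks 2 p"
    unfolding num_hooks_def by (rule card_image) (auto simp: inj_on_def)
  also have "num_hooks 2 p = card (gap_parts (set p)) + card (repeated_parts (mset p))"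
    using Cons by simp
  also have "card ?top = (if count (mset p) a = 1 then 1 else 0)
      + (if 2 \<le> a \<and> a \<notin> set p \<and> a - 1 \<notin> set p then 1 else 0)"
    by (rule top_row_hooks[OF le pos])
  finally have hooks: "num_hooks 2 (a # p) = (if count (mset p) a = 1 then 1 else 0)
      + (if 2 \<le> a \<and> a \<notin> set p \<and> a - 1 \<notin> set p then 1 else 0)
      + (card (gap_parts (set p)) + card (repeated_parts (mset p)))" .
  \<comment> \<open>No part of \<open>p\<close> exceeds \<open>a\<close>, so adding \<open>a\<close>
    cannot fill the gap below an old part; only \<open>a\<close> itself can become a new gap
    part.\<close>
  have "x - 1 \<noteq> a" if "x \<in> set p" for x
    using le pos that by force
  then have "gap_parts (set (a # p)) = gap_parts (set p) \<union>
      (if 2 \<le> a \<and> a \<notin> set p \<and> a - 1 \<notin> set p then {a} else {})"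
    by (auto simp: gap_parts_def)
  then have gaps: "card (gap_parts (set (a # p))) = card (gap_parts (set p)) +
      (if 2 \<le> a \<and> a \<notin> set p \<and> a - 1 \<notin> set p then 1 else 0)"
    by (auto simp: gap_parts_def)
  \<comment> \<open>\<open>a\<close> becomes repeated exactly on passing from one copy to two, the
    leg condition of \<open>top_row_hooks\<close>.\<close>
  have "x \<in> repeated_parts (mset (a # p)) \<longleftrightarrow>
      x \<in> repeated_parts (mset p) \<or> x = a \<and> count (mset p) a = 1" for x
  proof -
    have "count (mset (a # p)) x = (if x = a then Suc (count (mset p) a) else count (mset p) x)"
      by simp
    then show ?thesis
      unfolding repeated_parts_def mem_Collect_eq by presburger
  qed
  then have "repeated_parts (mset (a # p)) = repeated_parts (mset p) \<union>
      (if count (mset p) a = 1 then {a} else {})"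
    by auto
  moreover have "a \<notin> repeated_parts (mset p)" if "count (mset p) a = 1"
    using that by (simp add: repeated_parts_def)
  ultimately have reps: "card (repeated_parts (mset (a # p))) = card (repeated_parts (mset p)) +
      (if count (mset p) a = 1 then 1 else 0)"
    by simp
  show ?case using hooks gaps reps by simp
qed

lemma sum_card_fibres:
  fixes g :: "nat \<Rightarrow> nat"
  assumes "finite A" "\<And>p. p \<in> A \<Longrightarrow> f p \<le> n"
  shows "(\<Sum>m\<le>n. g m * card {p \<in> A. f p = m}) = (\<Sum>p\<in>A. g (f p))"
proof -
  have "(\<Sum>m\<le>n. \<Sum>p\<in>{p \<in> A. f p = m}. g (f p)) = (\<Sum>p\<in>A. g (f p))"
    using assms by (intro sum.group) auto
  then show ?thesis by (simp add: mult.commute)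
qed

section \<open>Partitions into odd parts\<close>

text \<open>Multisets turn the presence of a chosen pair of parts into an inclusion. The strict
  bound avoids truncated subtraction, so that \<open>M = 0\<close> can be a base case.\<close>

definition odd_msets :: "nat \<Rightarrow> nat \<Rightarrow> nat multiset set" where
  "odd_msets M n = {P. (\<forall>x\<in>#P. odd x \<and> x < 2 * M) \<and> sum_mset P = n}"

lemma bij_betw_mset_odd:
  assumes "1 \<le> M"
  shows "bij_betw mset {p \<in> partitions n. \<forall>x\<in>set p. odd x \<and> x \<le> 2 * M - 1} (odd_msets M n)"
proof (rule bij_betw_imageI)
  let ?A = "{p \<in> partitions n. \<forall>x\<in>set p. odd x \<and> x \<le> 2 * M - 1}"
  show "inj_on mset ?A"
  proof (rule inj_onI)
    fix p q assume "p \<in> ?A" "q \<in> ?A" "mset p = mset q"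
    then have "sorted (rev p)" "sorted (rev q)" "mset (rev p) = mset (rev q)"
      by (auto simp: partitions_def sorted_wrt_rev)
    then have "sort (rev q) = rev p" "sort (rev q) = rev q"
      by (auto intro: properties_for_sort)
    then have "rev p = rev q" by simp
    then show "p = q" by simp
  qed
  have le: "x \<le> 2 * M - 1 \<longleftrightarrow> x < 2 * M" for x using assms by linarith
  show "mset ` ?A = odd_msets M n"
  proof
    show "mset ` ?A \<subseteq> odd_msets M n"
      unfolding le by (rule image_subsetI) (simp add: odd_msets_def partitions_def sum_mset_sum_list)
    show "odd_msets M n \<subseteq> mset ` ?A"
    proof
      fix P assume P: "P \<in> odd_msets M n"
      let ?p = "rev (sorted_list_of_multiset P)"
      have "sum_list ?p = sum_mset P"
        using sum_mset_sum_list[of ?p] by simp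
      moreover have "0 \<notin># P"
        using P unfolding odd_msets_def by fastforce
      ultimately have "?p \<in> ?A"
        using P unfolding le by (simp add: odd_msets_def partitions_def sorted_wrt_rev)
      then show "P \<in> mset ` ?A"
        by (intro image_eqI[of _ _ ?p]) auto
    qed
  qed
qed

lemma finite_odd_msets [simp]: "finite (odd_msets M n)"
proof (cases "M = 0")
  case True
  then have "odd_msets M n \<subseteq> {{#}}" by (auto simp: odd_msets_def)
  then show ?thesis by (rule finite_subset) simp
next
  case False
  have "finite {p \<in> partitions n. \<forall>x\<in>set p. odd x \<and> x \<le> 2 * M - 1}"
    using finite_partitions[of n] by simp
  then show ?thesis
    using bij_betw_mset_odd[of M n] False by (simp add: bij_betw_finite)
qed

lemma sum_a\<^sub>2:
  assumes "1 \<le> M"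
  shows "(\<Sum>m. (m choose 2) * a\<^sub>2 M m n)
    = (\<Sum>P\<in>odd_msets M n. (card (gap_parts (set_mset P)) + card (repeated_parts P)) choose 2)"
proof -
  let ?A = "{p \<in> partitions n. \<forall>x\<in>set p. odd x \<and> x \<le> 2 * M - 1}"
  have a: "a\<^sub>2 M m n = card {p \<in> ?A. num_hooks 2 p = m}" for m
    by (simp add: a\<^sub>2_def)
  have "(\<Sum>m. (m choose 2) * a\<^sub>2 M m n) = (\<Sum>p\<in>?A. num_hooks 2 p choose 2)"
    unfolding suminf_a\<^sub>2 unfolding a
    by (rule sum_card_fibres) (use finite_partitions[of n] num_hooks_partition in auto)
  also have "\<dots> = (\<Sum>p\<in>?A. (card (gap_parts (set_mset (mset p))) + card (repeated_parts (mset p))) choose 2)"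
    by (intro sum.cong) (auto simp: num_hooks_2 partitions_def)
  also have "\<dots> = (\<Sum>P\<in>odd_msets M n. (card (gap_parts (set_mset P)) + card (repeated_parts P)) choose 2)"
    using bij_betw_mset_odd[OF assms]
    by (rule sum.reindex_bij_betw[where g = "\<lambda>P. (card (gap_parts (set_mset P)) + card (repeated_parts P)) choose 2"])
  finally show ?thesis .
qed

section \<open>Generating function of the partitions into bounded odd parts\<close>

definition odd_fps :: "nat \<Rightarrow> int fps" where
  "odd_fps M = Abs_fps (\<lambda>n. int (card (odd_msets M n)))"

text \<open>Removing \<open>R\<close> is a bijection onto the multisets of sum
  \<open>n - sum_mset R\<close>, which on generating functions is multiplication by a power of
  \<open>fps_X\<close>.\<close>

lemma card_odd_msets_supset:
  assumes "\<forall>x\<in>#R. odd x \<and> x < 2 * M"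
  shows "int (card {P \<in> odd_msets M n. R \<subseteq># P}) = (odd_fps M * fps_X ^ sum_mset R) $ n"
proof (cases "n < sum_mset R")
  case True
  then have "\<not> R \<subseteq># P" if "P \<in> odd_msets M n" for P
    using that sum_mset.union[of R "P - R"] by (simp add: odd_msets_def del: sum_mset.union) force
  then have "{P \<in> odd_msets M n. R \<subseteq># P} = {}"
    by blast
  then show ?thesis using True by (simp add: fps_X_power_mult_right_nth)
next
  case False
  have "{P \<in> odd_msets M n. R \<subseteq># P} = (+) R ` odd_msets M (n - sum_mset R)"
  proof (intro subset_antisym subsetI)
    fix P assume P: "P \<in> {P \<in> odd_msets M n. R \<subseteq># P}"
    then obtain Q where Q: "P = R + Q"
      unfolding mset_subset_eq_exists_conv by blast
    have "Q \<in> odd_msets M (n - sum_mset R)"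
      using P unfolding Q odd_msets_def by (clarsimp simp: ball_Un)
    then show "P \<in> (+) R ` odd_msets M (n - sum_mset R)"
      unfolding Q by blast
  next
    fix P assume "P \<in> (+) R ` odd_msets M (n - sum_mset R)"
    then obtain Q where Q: "P = R + Q" "Q \<in> odd_msets M (n - sum_mset R)" by blast
    then show "P \<in> {P \<in> odd_msets M n. R \<subseteq># P}"
      using assms False unfolding odd_msets_def by (simp add: ball_Un)
  qed
  then show ?thesis
    using False by (simp add: fps_X_power_mult_right_nth odd_fps_def card_image)
qed

lemma odd_fps_0: "odd_fps 0 = 1"
proof (rule fps_ext)
  fix n
  have "odd_msets 0 n = (if n = 0 then {{#}} else {})"
    by (auto simp: odd_msets_def)
  then show "odd_fps 0 $ n = 1 $ n"
    by (simp add: odd_fps_def)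
qed

text \<open>The multisets without the part \<open>2 * M + 1\<close> are all multisets minus those
  that contain it; the latter are counted by \<open>card_odd_msets_supset\<close>.\<close>

lemma odd_fps_Suc: "odd_fps (Suc M) * (1 - fps_X ^ (2 * M + 1)) = odd_fps M"
proof (rule fps_ext)
  fix n
  let ?b = "2 * M + 1"
  have "odd x \<and> x < 2 * Suc M \<longleftrightarrow> odd x \<and> x < 2 * M \<or> x = ?b" for x by presburger
  moreover have "\<not> ?b < 2 * M" by simp
  ultimately have "P \<in> odd_msets M n \<longleftrightarrow> P \<in> odd_msets (Suc M) n \<and> ?b \<notin># P" for P
    unfolding odd_msets_def mem_Collect_eq by metis
  then have "odd_msets M n = odd_msets (Suc M) n - {P \<in> odd_msets (Suc M) n. {#?b#} \<subseteq># P}"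
    unfolding single_subset_iff by blast
  then have "card (odd_msets (Suc M) n)
      = card (odd_msets M n) + card {P \<in> odd_msets (Suc M) n. {#?b#} \<subseteq># P}"
    by (simp add: card_Diff_subset card_mono)
  then have "odd_fps (Suc M) $ n = odd_fps M $ n + (odd_fps (Suc M) * fps_X ^ ?b) $ n"
    using card_odd_msets_supset[of "{#?b#}" "Suc M" n] by (simp add: odd_fps_def)
  then show "(odd_fps (Suc M) * (1 - fps_X ^ ?b)) $ n = odd_fps M $ n"
    by (simp only: right_diff_distrib mult_1_right fps_sub_nth)
qed

section \<open>Lower bound for the odd side by pairs of parts\<close>

text \<open>Each pair is encoded as a two-element subset of the disjoint union
  \<open>X <+> Y\<close>: an off-diagonal pair lies in the left copy, a diagonal pair joins the two
  copies of \<open>i\<close>.\<close>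

lemma card_pairs_le_choose_2:
  fixes X Y :: "nat set"
  assumes "finite X" "finite Y"
  shows "card ({(i, j). i \<in> X \<and> j \<in> X \<and> i < j} \<union> {(i, i) |i. i \<in> X \<inter> Y}) \<le> (card X + card Y) choose 2"
proof -
  let ?f = "\<lambda>(i, j). if i < j then {Inl i, Inl j} else {Inl i, Inr i :: nat + nat}"
  let ?A = "{(i, j). i \<in> X \<and> j \<in> X \<and> i < j} \<union> {(i, i) |i. i \<in> X \<inter> Y}"
  have "inj_on ?f ?A"
    by (auto simp: inj_on_def doubleton_eq_iff)
  moreover have "?f ` ?A \<subseteq> {B. B \<subseteq> X <+> Y \<and> card B = 2}"
    by auto
  moreover have "finite {B. B \<subseteq> X <+> Y \<and> card B = 2}"
    using assms by simp
  ultimately have "card ?A \<le> card {B. B \<subseteq> X <+> Y \<and> card B = 2}"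
    by (rule card_inj_on_le)
  also have "\<dots> = (card X + card Y) choose 2"
    using assms by (simp add: n_subsets card_Plus)
  finally show ?thesis .
qed

text \<open>When all parts are odd, the number below a part is never a part, so every part from 3 on
  is a gap part. A pair with \<open>a = b\<close> requires a repeated part.\<close>

lemma pairs_of_odd_parts_le:
  assumes "\<forall>x\<in>#P. odd x \<and> x < 2 * (N + 2)"
  shows "card {(a, b). a \<le> b \<and> b \<le> N \<and> {#2 * a + 3, 2 * b + 3#} \<subseteq># P}
    \<le> (card (gap_parts (set_mset P)) + card (repeated_parts P)) choose 2"
proof -
  let ?G = "gap_parts (set_mset P)" and ?R = "repeated_parts P"
  let ?A = "{(a, b). a \<le> b \<and> b \<le> N \<and> {#2 * a + 3, 2 * b + 3#} \<subseteq># P}"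
  let ?B = "{(i, j). i \<in> ?G \<and> j \<in> ?G \<and> i < j} \<union> {(i, i) |i. i \<in> ?G \<inter> ?R}"
  let ?f = "\<lambda>(a, b). (2 * a + 3, 2 * b + 3) :: nat \<times> nat"
  have gap: "2 * a + 3 \<in> ?G" if "2 * a + 3 \<in># P" for a
    using that assms by (force simp: gap_parts_def)
  have "?f ` ?A \<subseteq> ?B"
  proof (rule image_subsetI)
    fix c assume "c \<in> ?A"
    then obtain a b where c: "c = (a, b)" "a \<le> b" and sub: "{#2 * a + 3, 2 * b + 3#} \<subseteq># P"
      by auto
    have mem: "2 * a + 3 \<in> ?G" "2 * b + 3 \<in> ?G"
      using mset_subset_eqD[OF sub] gap by auto
    have "2 * a + 3 \<in> ?R" if "a = b"
      using mset_subset_eq_count[OF sub, of "2 * a + 3"] that by (simp add: repeated_parts_def)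
    then show "?f c \<in> ?B"
      using c mem by (cases "a = b") auto
  qed
  moreover have "finite ?B"
    by (rule finite_subset[of _ "?G \<times> ?G"]) auto
  moreover have "inj_on ?f ?A"
    by (auto simp: inj_on_def)
  ultimately have "card ?A \<le> card ?B"
    by (meson card_inj_on_le)
  also have "\<dots> \<le> (card ?G + card ?R) choose 2"
    by (rule card_pairs_le_choose_2) auto
  finally show ?thesis .
qed

definition pairs :: "nat \<Rightarrow> (nat \<times> nat) set" where
  "pairs N = {(a, b). a \<le> b \<and> b \<le> N}"

lemma finite_pairs [simp]: "finite (pairs N)"
  by (rule finite_subset[of _ "{..N} \<times> {..N}"]) (auto simp: pairs_def)

text \<open>Double counting of the pairs contained in a partition: the series counts the partitions
  for each pair, and the sums are then swapped to count the pairs for each partition.\<close>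

lemma sum_a\<^sub>2_ge:
  "(odd_fps (N + 2) * (\<Sum>(a, b)\<in>pairs N. fps_X ^ (2 * a + 3 + (2 * b + 3)))) $ n
    \<le> int (\<Sum>m. (m choose 2) * a\<^sub>2 (N + 2) m n)"
proof -
  let ?R = "\<lambda>(a, b). {#2 * a + 3, 2 * b + 3#} :: nat multiset"
  have "(odd_fps (N + 2) * (\<Sum>(a, b)\<in>pairs N. fps_X ^ (2 * a + 3 + (2 * b + 3)))) $ n
      = (\<Sum>c\<in>pairs N. (odd_fps (N + 2) * fps_X ^ sum_mset (?R c)) $ n)"
    by (simp add: sum_distrib_left fps_sum_nth case_prod_unfold)
  also have "\<dots> = (\<Sum>c\<in>pairs N. int (card {P \<in> odd_msets (N + 2) n. ?R c \<subseteq># P}))"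
  proof (intro sum.cong refl card_odd_msets_supset[symmetric])
    fix c assume "c \<in> pairs N"
    then show "\<forall>x\<in>#?R c. odd x \<and> x < 2 * (N + 2)"
      by (cases c) (simp add: pairs_def)
  qed
  also have "\<dots> = int (\<Sum>c\<in>pairs N. \<Sum>P\<in>odd_msets (N + 2) n. if ?R c \<subseteq># P then 1 else 0)"
    by (simp add: sum.inter_filter[symmetric])
  also have "(\<Sum>c\<in>pairs N. \<Sum>P\<in>odd_msets (N + 2) n. if ?R c \<subseteq># P then 1 else 0)
      = (\<Sum>P\<in>odd_msets (N + 2) n. \<Sum>c\<in>pairs N. if ?R c \<subseteq># P then 1 else (0::nat))"
    by (rule sum.swap)
  also have "\<dots> = (\<Sum>P\<in>odd_msets (N + 2) n. card {(a, b). a \<le> b \<and> b \<le> N \<and> {#2 * a + 3, 2 * b + 3#} \<subseteq># P})"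
  proof (rule sum.cong[OF refl])
    fix P
    have "{c \<in> pairs N. ?R c \<subseteq># P} = {(a, b). a \<le> b \<and> b \<le> N \<and> {#2 * a + 3, 2 * b + 3#} \<subseteq># P}"
      by (auto simp: pairs_def)
    then show "(\<Sum>c\<in>pairs N. if ?R c \<subseteq># P then 1 else (0::nat))
        = card {(a, b). a \<le> b \<and> b \<le> N \<and> {#2 * a + 3, 2 * b + 3#} \<subseteq># P}"
      by (simp add: sum.inter_filter[symmetric])
  qed
  also have "int \<dots> \<le> int (\<Sum>P\<in>odd_msets (N + 2) n. (card (gap_parts (set_mset P)) + card (repeated_parts P)) choose 2)"
    unfolding of_nat_le_iff by (intro sum_mono pairs_of_odd_parts_le) (simp add: odd_msets_def)
  also have "\<dots> = int (\<Sum>m. (m choose 2) * a\<^sub>2 (N + 2) m n)"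
    by (simp add: sum_a\<^sub>2)
  finally show ?thesis .
qed

section \<open>Partitions into distinct parts\<close>

text \<open>The coefficient of \<open>q^n\<close> in \<open>gap_fps k L\<close> is the \<open>k\<close>-th binomial moment of the number of
  hooks of length two over the partitions of \<open>n\<close> into distinct parts up to \<open>L\<close>.\<close>

definition gap_fps :: "nat \<Rightarrow> nat \<Rightarrow> int fps" where
  "gap_fps k L = (\<Sum>S\<in>Pow {1..L}. of_nat (card (gap_parts S) choose k) * fps_X ^ \<Sum>S)"

definition distinct_fps :: "nat \<Rightarrow> int fps" where
  "distinct_fps L = (\<Prod>i=1..L. 1 + fps_X ^ i)"

lemma bij_betw_set_distinct:
  "bij_betw set {p \<in> partitions n. distinct p \<and> (\<forall>x\<in>set p. x \<le> L)} {S. S \<subseteq> {1..L} \<and> \<Sum>S = n}"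
proof (rule bij_betw_imageI)
  let ?A = "{p \<in> partitions n. distinct p \<and> (\<forall>x\<in>set p. x \<le> L)}"
  show "inj_on set ?A"
  proof (rule inj_onI)
    fix p q assume "p \<in> ?A" "q \<in> ?A" "set p = set q"
    then have "rev p = rev q"
      by (intro sorted_distinct_set_unique) (auto simp: partitions_def sorted_wrt_rev)
    then show "p = q" by simp
  qed
  show "set ` ?A = {S. S \<subseteq> {1..L} \<and> \<Sum>S = n}"
  proof
    show "set ` ?A \<subseteq> {S. S \<subseteq> {1..L} \<and> \<Sum>S = n}"
    proof clarify
      fix p assume p: "p \<in> partitions n" "distinct p" "\<forall>x\<in>set p. x \<le> L"
      have "\<Sum>(set p) = n"
        using p distinct_sum_list_conv_Sum[of p] by (simp add: partitions_def)
      moreover have "0 \<notin> set p"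
        using p(1) by (simp add: partitions_def)
      then have "1 \<le> x" if "x \<in> set p" for x
        using that by (cases "x = 0") auto
      ultimately show "set p \<subseteq> {1..L} \<and> \<Sum>(set p) = n"
        using p by auto
    qed
    show "{S. S \<subseteq> {1..L} \<and> \<Sum>S = n} \<subseteq> set ` ?A"
    proof clarify
      fix S :: "nat set" assume S: "S \<subseteq> {1..L}" "n = \<Sum>S"
      let ?p = "rev (sorted_list_of_set S)"
      have fin: "finite S" using S(1) by (rule finite_subset) simp
      have "sum_list ?p = \<Sum>S"
        using fin distinct_sum_list_conv_Sum[of ?p] by simp
      then have "?p \<in> partitions (\<Sum>S)"
        using S fin by (auto simp: partitions_def sorted_wrt_rev)
      then show "S \<in> set ` {p \<in> partitions (\<Sum>S). distinct p \<and> (\<forall>x\<in>set p. x \<le> L)}"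
        using S fin by (intro image_eqI[of _ _ ?p]) auto
    qed
  qed
qed

lemma num_hooks_2_distinct:
  assumes "p \<in> partitions n" "distinct p"
  shows "num_hooks 2 p = card (gap_parts (set p))"
proof -
  have "count (mset p) x < 2" for x
    using assms(2) by (simp add: distinct_count_atmost_1)
  then have "repeated_parts (mset p) = {}"
    by (simp add: repeated_parts_def not_le)
  then show ?thesis
    using assms by (simp add: num_hooks_2 partitions_def)
qed

lemma sum_b\<^sub>2:
  "(\<Sum>m. (m choose 2) * b\<^sub>2 L m n) = (\<Sum>S | S \<subseteq> {1..L} \<and> \<Sum>S = n. card (gap_parts S) choose 2)"
proof -
  let ?A = "{p \<in> partitions n. distinct p \<and> (\<forall>x\<in>set p. x \<le> L)}"
  have b: "b\<^sub>2 L m n = card {p \<in> ?A. num_hooks 2 p = m}" for m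
    by (simp add: b\<^sub>2_def)
  have "(\<Sum>m. (m choose 2) * b\<^sub>2 L m n) = (\<Sum>p\<in>?A. num_hooks 2 p choose 2)"
    unfolding suminf_b\<^sub>2 unfolding b
    by (rule sum_card_fibres) (use finite_partitions[of n] num_hooks_partition in auto)
  also have "\<dots> = (\<Sum>p\<in>?A. card (gap_parts (set p)) choose 2)"
    by (intro sum.cong) (auto simp: num_hooks_2_distinct)
  also have "\<dots> = (\<Sum>S | S \<subseteq> {1..L} \<and> \<Sum>S = n. card (gap_parts S) choose 2)"
    by (rule sum.reindex_bij_betw[OF bij_betw_set_distinct, where g = "\<lambda>S. card (gap_parts S) choose 2"])
  finally show ?thesis .
qed

lemma of_nat_mult_fps_X_power_nth:
  "(of_nat c * fps_X ^ k :: int fps) $ n = (if k = n then int c else 0)"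
  by (simp flip: fps_of_nat)

text \<open>Enlarging the bound only adds nonnegative terms; this allows an odd \<open>L\<close> to
  be replaced by the next even number.\<close>

lemma sum_b\<^sub>2_le:
  assumes "L \<le> L'"
  shows "int (\<Sum>m. (m choose 2) * b\<^sub>2 L m n) \<le> gap_fps 2 L' $ n"
proof -
  have "(\<Sum>S | S \<subseteq> {1..L} \<and> \<Sum>S = n. card (gap_parts S) choose 2)
      \<le> (\<Sum>S\<in>{S \<in> Pow {1..L'}. \<Sum>S = n}. card (gap_parts S) choose 2)"
    using assms by (intro sum_mono2) auto
  also have "int \<dots> = gap_fps 2 L' $ n"
    unfolding gap_fps_def fps_sum_nth of_nat_mult_fps_X_power_nth of_nat_sum
    by (rule sum.inter_filter) simp
  finally show ?thesis by (simp add: sum_b\<^sub>2)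
qed

section \<open>Recurrence and closed form for the binomial moments\<close>

lemma sum_Pow_Suc:
  "(\<Sum>S\<in>Pow {Suc 0..Suc L}. f S) = (\<Sum>S\<in>Pow {Suc 0..L}. f S) + (\<Sum>S\<in>Pow {Suc 0..L}. f (insert (Suc L) S))"
proof -
  have "Pow {Suc 0..Suc L} = Pow {Suc 0..L} \<union> insert (Suc L) ` Pow {Suc 0..L}"
    by (simp add: atLeastAtMostSuc_conv Pow_insert)
  moreover have "Pow {Suc 0..L} \<inter> insert (Suc L) ` Pow {Suc 0..L} = {}"
    by auto
  moreover have "inj_on (insert (Suc L)) (Pow {Suc 0..L})"
  proof (rule inj_onI)
    fix S T assume "S \<in> Pow {Suc 0..L}" "T \<in> Pow {Suc 0..L}" and eq: "insert (Suc L) S = insert (Suc L) T"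
    then have "Suc L \<notin> S" "Suc L \<notin> T" by auto
    then show "S = T" using eq by (metis Diff_insert_absorb)
  qed
  ultimately show ?thesis
    by (simp add: sum.union_disjoint sum.reindex)
qed

lemma sum_insert_Suc: "S \<in> Pow {1..L} \<Longrightarrow> \<Sum>(insert (Suc L) S) = Suc L + \<Sum>S"
  by (subst sum.insert) (auto intro: finite_subset)

text \<open>The new element is the largest, so it leaves the status of all others unchanged and is
  itself a gap part iff its predecessor is missing.\<close>

lemma card_gap_parts_insert:
  assumes "S \<in> Pow {1..Suc L}"
  shows "card (gap_parts (insert (L + 2) S)) = card (gap_parts S) + (if Suc L \<in> S then 0 else 1)"
proof -
  have fin: "finite S" using assms by (auto intro: finite_subset)
  have "x - 1 \<noteq> L + 2" "L + 2 \<noteq> x" if "x \<in> S" for x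
    using assms that by fastforce+
  then have "gap_parts (insert (L + 2) S) = gap_parts S \<union> (if Suc L \<in> S then {} else {L + 2})"
    by (auto simp: gap_parts_def)
  moreover have "L + 2 \<notin> gap_parts S"
    using assms by (auto simp: gap_parts_def)
  ultimately show ?thesis using fin by simp
qed

text \<open>The sets are split by whether they contain \<open>L + 2\<close>. If they do and avoid
  \<open>L + 1\<close>, the number of gap parts grows by one, and Pascal's rule adds the
  \<open>k\<close>-th moment over the subsets of \<open>{1..L}\<close>.\<close>

lemma gap_fps_rec:
  "gap_fps (Suc k) (L + 2) = (1 + fps_X ^ (L + 2)) * gap_fps (Suc k) (L + 1) + fps_X ^ (L + 2) * gap_fps k L"
proof -
  let ?g = "\<lambda>S. card (gap_parts S)"
  \<comment> \<open>The extra term of Pascal's rule, present only when the inserted element is a gap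
    part.\<close>
  let ?new = "\<lambda>S. if Suc L \<in> S then 0 else of_nat (?g S choose k) * fps_X ^ \<Sum>S :: int fps"
  have "of_nat (?g (insert (Suc (Suc L)) S) choose Suc k) * fps_X ^ \<Sum>(insert (Suc (Suc L)) S)
      = fps_X ^ (L + 2) * (of_nat (?g S choose Suc k) * fps_X ^ \<Sum>S + ?new S)"
    if "S \<in> Pow {1..Suc L}" for S
    using card_gap_parts_insert[OF that] sum_insert_Suc[OF that] by (simp add: power_add algebra_simps)
  then have "gap_fps (Suc k) (L + 2) = gap_fps (Suc k) (L + 1)
      + fps_X ^ (L + 2) * (\<Sum>S\<in>Pow {1..Suc L}. of_nat (?g S choose Suc k) * fps_X ^ \<Sum>S + ?new S)"
    unfolding gap_fps_def by (simp add: sum_Pow_Suc[of _ "Suc L"] sum_distrib_left)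
  also have "(\<Sum>S\<in>Pow {1..Suc L}. of_nat (?g S choose Suc k) * fps_X ^ \<Sum>S + ?new S)
      = gap_fps (Suc k) (L + 1) + (\<Sum>S\<in>Pow {1..Suc L}. ?new S)"
    by (simp add: gap_fps_def sum.distrib)
  also have "(\<Sum>S\<in>Pow {1..Suc L}. ?new S) = (\<Sum>S\<in>Pow {1..L}. ?new S)"
    by (simp add: sum_Pow_Suc)
  also have "\<dots> = gap_fps k L"
    unfolding gap_fps_def by (rule sum.cong) auto
  finally show ?thesis by (simp add: algebra_simps)
qed

lemma distinct_fps_Suc: "distinct_fps (Suc L) = distinct_fps L * (1 + fps_X ^ Suc L)"
  by (simp add: distinct_fps_def)

lemma gap_fps_0: "gap_fps 0 L = distinct_fps L"
proof (induction L)
  case 0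
  show ?case by (simp add: gap_fps_def distinct_fps_def)
next
  case (Suc L)
  have "(\<Sum>S\<in>Pow {1..L}. fps_X ^ \<Sum>(insert (Suc L) S)) = (\<Sum>S\<in>Pow {1..L}. fps_X ^ \<Sum>S * fps_X ^ Suc L :: int fps)"
    by (intro sum.cong refl) (simp only: sum_insert_Suc power_add mult.commute)
  then have "gap_fps 0 (Suc L) = gap_fps 0 L * (1 + fps_X ^ Suc L)"
    by (simp add: gap_fps_def sum_Pow_Suc distrib_left flip: sum_distrib_right)
  then show ?case by (simp only: Suc distinct_fps_Suc)
qed

lemma gap_fps_init: "0 < k \<Longrightarrow> gap_fps k 0 = 0" "0 < k \<Longrightarrow> gap_fps k (Suc 0) = 0"
proof -
  have "gap_parts {} = {}" "gap_parts {Suc 0} = {}"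
    by (auto simp: gap_parts_def)
  then show "0 < k \<Longrightarrow> gap_fps k 0 = 0" "0 < k \<Longrightarrow> gap_fps k (Suc 0) = 0"
    by (simp_all add: gap_fps_def Pow_insert binomial_eq_0)
qed

text \<open>The denominator of the closed form is kept on the left, so that the induction stays
  within ring identities in \<open>fps_X\<close> and \<open>fps_X ^ L\<close>.\<close>

lemma gap_fps_1:
  "(1 - fps_X ^ 2) * gap_fps 1 (L + 1) = fps_X ^ 2 * distinct_fps L * (1 - fps_X ^ L)"
proof (induction L)
  case 0
  show ?case by (simp add: gap_fps_init)
next
  case (Suc L)
  let ?X = "fps_X :: int fps" and ?q = "fps_X ^ L :: int fps"
  have "(1 - ?X ^ 2) * gap_fps 1 (Suc L + 1)
      = (1 + ?X ^ 2 * ?q) * ((1 - ?X ^ 2) * gap_fps 1 (L + 1)) + (1 - ?X ^ 2) * (?X ^ 2 * ?q * distinct_fps L)"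
    using gap_fps_rec[of 0 L] by (simp add: gap_fps_0 power_add algebra_simps power2_eq_square)
  \<comment> \<open>Beside \<open>?X ^ 2 * distinct_fps L\<close>, the remaining factor collapses to
    \<open>1 - ?X ^ 2 * ?q ^ 2\<close>, a difference of squares; one of its factors extends the
    product to \<open>Suc L\<close>.\<close>
  also have "\<dots> = ?X ^ 2 * (distinct_fps L * (1 + ?X * ?q)) * (1 - ?X * ?q)"
    unfolding Suc by algebra
  finally show ?case by (simp add: distinct_fps_Suc)
qed

lemma gap_fps_2_eq_0: "gap_fps 2 2 = 0"
  using gap_fps_rec[of 1 0] by (simp add: gap_fps_init numeral_2_eq_2)

text \<open>Same method as for the first moment, which enters here as the inhomogeneous term. The
  power \<open>fps_X ^ 6\<close> belongs to the smallest set with two gap parts,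
  \<open>{2, 4}\<close>.\<close>

lemma gap_fps_2:
  "(1 - fps_X ^ 2) * (1 - fps_X ^ 4) * gap_fps 2 (L + 3)
    = fps_X ^ 6 * distinct_fps (L + 1) * (1 - fps_X ^ (L + 1)) * (1 - fps_X ^ L)"
proof (induction L)
  case 0
  have "gap_fps 2 3 = (1 + fps_X ^ 3) * gap_fps 2 2 + fps_X ^ 3 * gap_fps 1 1"
    using gap_fps_rec[of 1 1] by (simp add: eval_nat_numeral)
  then show ?case by (simp add: gap_fps_2_eq_0 gap_fps_init)
next
  case (Suc L)
  let ?X = "fps_X :: int fps" and ?q = "fps_X ^ L :: int fps"
  have rec: "gap_fps 2 (Suc L + 3) = (1 + ?X ^ 4 * ?q) * gap_fps 2 (L + 3) + ?X ^ 4 * ?q * gap_fps 1 (L + 1 + 1)"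
    using gap_fps_rec[of 1 "L + 2"]
    by (simp add: numeral_2_eq_2 numeral_3_eq_3 power_add eval_nat_numeral algebra_simps)
  have "(1 - ?X ^ 2) * (1 - ?X ^ 4) * gap_fps 2 (Suc L + 3)
      = (1 + ?X ^ 4 * ?q) * ((1 - ?X ^ 2) * (1 - ?X ^ 4) * gap_fps 2 (L + 3))
        + ?X ^ 4 * ?q * (1 - ?X ^ 4) * ((1 - ?X ^ 2) * gap_fps 1 (L + 1 + 1))"
    unfolding rec by algebra
  also have "\<dots> = ?X ^ 6 * (distinct_fps (L + 1) * (1 + ?X ^ 2 * ?q)) * (1 - ?X ^ 2 * ?q) * (1 - ?X * ?q)"
    unfolding Suc gap_fps_1 power_add power_one_right by algebra
  finally show ?case
    by (simp add: distinct_fps_Suc power2_eq_square mult.assoc)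
qed

lemma one_minus_fps_X_power_nonzero: "0 < k \<Longrightarrow> 1 - fps_X ^ k \<noteq> (0 :: int fps)"
  by (metis diff_self fps_sub_nth fps_one_nth fps_X_power_nth fps_zero_nth diff_zero less_irrefl zero_neq_one)

text \<open>For an even bound, the two top factors of \<open>distinct_fps (2 * N + 2)\<close> pair
  with the two differences in \<open>gap_fps_2\<close> to give \<open>1 - q^(4 * N + 4)\<close> and
  \<open>1 - q^(4 * N + 2)\<close>. Dividing by \<open>1 - q^4\<close> and \<open>1 - q^2\<close>
  leaves geometric sums.\<close>

lemma gap_fps_2_even:
  "gap_fps 2 (2 * N + 4) = fps_X ^ 6 * distinct_fps (2 * N)
    * ((\<Sum>i<N + 1. (fps_X ^ 4) ^ i) * (\<Sum>j<2 * N + 1. (fps_X ^ 2) ^ j))"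
proof -
  let ?X = "fps_X :: int fps"
  let ?c = "(1 - ?X ^ 2) * (1 - ?X ^ 4)"
  have "?c * gap_fps 2 (2 * N + 4)
      = ?X ^ 6 * distinct_fps (2 * N + 2) * (1 - ?X ^ (2 * N + 2)) * (1 - ?X ^ (2 * N + 1))"
    using gap_fps_2[of "2 * N + 1"] by (simp add: eval_nat_numeral)
  also have "distinct_fps (2 * N + 2) = distinct_fps (2 * N) * (1 + ?X ^ (2 * N + 1)) * (1 + ?X ^ (2 * N + 2))"
    by (simp add: distinct_fps_Suc)
  also have "?X ^ 6 * (distinct_fps (2 * N) * (1 + ?X ^ (2 * N + 1)) * (1 + ?X ^ (2 * N + 2)))
        * (1 - ?X ^ (2 * N + 2)) * (1 - ?X ^ (2 * N + 1))
      = ?X ^ 6 * distinct_fps (2 * N) * ((1 - (?X ^ (2 * N + 2)) ^ 2) * (1 - (?X ^ (2 * N + 1)) ^ 2))"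
    by algebra
  also have "1 - (?X ^ (2 * N + 2)) ^ 2 = 1 - (?X ^ 4) ^ (N + 1)"
  proof -
    have "(2 * N + 2) * 2 = 4 * (N + 1)" by simp
    then show ?thesis by (simp only: power_mult[symmetric])
  qed
  also have "\<dots> = (1 - ?X ^ 4) * (\<Sum>i<N + 1. (?X ^ 4) ^ i)"
    by (rule one_diff_power_eq)
  also have "1 - (?X ^ (2 * N + 1)) ^ 2 = 1 - (?X ^ 2) ^ (2 * N + 1)"
    by (simp only: mult.commute flip: power_mult)
  also have "\<dots> = (1 - ?X ^ 2) * (\<Sum>j<2 * N + 1. (?X ^ 2) ^ j)"
    by (rule one_diff_power_eq)
  finally have "?c * gap_fps 2 (2 * N + 4) = ?c * (?X ^ 6 * distinct_fps (2 * N)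
      * ((\<Sum>i<N + 1. (?X ^ 4) ^ i) * (\<Sum>j<2 * N + 1. (?X ^ 2) ^ j)))"
    by (simp only: mult_ac)
  moreover have "?c \<noteq> 0"
    using one_minus_fps_X_power_nonzero[of 2] one_minus_fps_X_power_nonzero[of 4] by simp
  ultimately show ?thesis
    by (simp only: mult_cancel_left) simp
qed

section \<open>Coefficientwise comparison\<close>

definition nonneg_fps :: "int fps \<Rightarrow> bool" where
  "nonneg_fps f \<longleftrightarrow> (\<forall>n. 0 \<le> f $ n)"

lemma nonneg_fps_add: "nonneg_fps f \<Longrightarrow> nonneg_fps g \<Longrightarrow> nonneg_fps (f + g)"
  by (simp add: nonneg_fps_def)

lemma nonneg_fps_mult: "nonneg_fps f \<Longrightarrow> nonneg_fps g \<Longrightarrow> nonneg_fps (f * g)"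
  by (simp add: nonneg_fps_def fps_mult_nth sum_nonneg)

lemma nonneg_fps_1: "nonneg_fps 1"
  by (simp add: nonneg_fps_def)

lemma nonneg_fps_X_power: "nonneg_fps (fps_X ^ k)"
  by (simp add: nonneg_fps_def)

lemma nonneg_fps_sum: "(\<And>x. x \<in> A \<Longrightarrow> nonneg_fps (f x)) \<Longrightarrow> nonneg_fps (sum f A)"
  by (simp add: nonneg_fps_def fps_sum_nth sum_nonneg)

lemma nonneg_fps_prod: "(\<And>x. x \<in> A \<Longrightarrow> nonneg_fps (f x)) \<Longrightarrow> nonneg_fps (prod f A)"
  by (induction A rule: infinite_finite_induct) (auto intro: nonneg_fps_mult nonneg_fps_1)

lemmas nonneg_fps_intros =
  nonneg_fps_add nonneg_fps_mult nonneg_fps_1 nonneg_fps_X_power nonneg_fps_sum nonneg_fps_prod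

text \<open>Division by \<open>1 - fps_X ^ k\<close> preserves nonnegativity: the coefficient at
  \<open>n\<close> is that of the product plus the earlier coefficient at \<open>n - k\<close>, if
  there is one.\<close>

lemma nonneg_fps_divide:
  assumes "nonneg_fps (f * (1 - fps_X ^ k))" "0 < k"
  shows "nonneg_fps f"
  unfolding nonneg_fps_def
proof
  fix n show "0 \<le> f $ n"
  proof (induction n rule: less_induct)
    case (less n)
    have "f = f * (1 - fps_X ^ k) + f * fps_X ^ k"
      by (simp add: algebra_simps)
    then have "f $ n = (f * (1 - fps_X ^ k)) $ n + (f * fps_X ^ k) $ n"
      by (metis fps_add_nth)
    moreover have "0 \<le> (f * fps_X ^ k) $ n"
      using less assms(2) by (simp add: fps_X_power_mult_right_nth)
    ultimately show ?case
      using assms(1) by (simp add: nonneg_fps_def)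
  qed
qed

text \<open>The reciprocal of the product dominates \<open>1\<close> plus the sum of the single
  powers. Stating this for \<open>f\<close> times the product avoids reciprocals.\<close>

lemma nonneg_fps_divide_prod:
  assumes "finite I" "0 \<notin> I" "nonneg_fps (f * (\<Prod>i\<in>I. 1 - fps_X ^ i))"
  shows "nonneg_fps (f - f * (\<Prod>i\<in>I. 1 - fps_X ^ i) * (1 + (\<Sum>i\<in>I. fps_X ^ i)))"
  using assms
proof (induction I arbitrary: f rule: finite_induct)
  case empty
  then show ?case by (simp add: nonneg_fps_def)
next
  case (insert i I)
  let ?X = "fps_X ^ i :: int fps" and ?S = "\<Sum>i\<in>I. fps_X ^ i :: int fps"
  let ?f' = "f * (1 - ?X)"
  define q where "q = f * (\<Prod>i\<in>insert i I. 1 - fps_X ^ i)"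
  have q: "q = ?f' * (\<Prod>i\<in>I. 1 - fps_X ^ i)"
    using insert.hyps by (simp add: q_def mult.assoc)
  have nq: "nonneg_fps q" using insert.prems by (simp add: q_def)
  have nS: "nonneg_fps ?S" by (intro nonneg_fps_intros)
  have IH: "nonneg_fps (?f' - q * (1 + ?S))"
    using insert.IH[of ?f'] insert.prems nq by (simp add: q)
  have "nonneg_fps ((?f' - q * (1 + ?S)) + q * (1 + ?S))"
    by (intro nonneg_fps_intros IH nq nS)
  then have f: "nonneg_fps f"
    using insert.prems by (intro nonneg_fps_divide[of f i]) auto
  \<comment> \<open>The relation \<open>f = ?f' + ?X * f\<close> is unrolled twice; the
    \<open>?f'\<close> in the middle supplies the new term \<open>q * ?X\<close>.\<close>
  have "nonneg_fps ((?f' - q * (1 + ?S)) + ?X * ((?f' - q * (1 + ?S)) + q * ?S + ?X * f))"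
    by (intro nonneg_fps_intros IH nq nS f)
  also have "(?f' - q * (1 + ?S)) + ?X * ((?f' - q * (1 + ?S)) + q * ?S + ?X * f) = f - q * (1 + (?X + ?S))"
    by algebra
  finally show ?case
    using insert.hyps by (simp add: q_def)
qed

text \<open>An exponent-preserving injection cancels all subtracted monomials and leaves those
  outside its image.\<close>

lemma nonneg_fps_diff_sum:
  assumes "finite A" "inj_on h B" "h ` B \<subseteq> A" "\<And>y. y \<in> B \<Longrightarrow> f (h y) = g y"
  shows "nonneg_fps ((\<Sum>x\<in>A. fps_X ^ f x) - (\<Sum>y\<in>B. fps_X ^ g y))"
proof -
  have "(\<Sum>y\<in>B. fps_X ^ g y) = (\<Sum>x\<in>h ` B. fps_X ^ f x :: int fps)"
    using assms(2,4) by (simp add: sum.reindex)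
  moreover have "(\<Sum>x\<in>A. fps_X ^ f x) - (\<Sum>x\<in>h ` B. fps_X ^ f x :: int fps) = (\<Sum>x\<in>A - h ` B. fps_X ^ f x)"
    using assms(1,3) finite_subset by (subst sum_diff) auto
  ultimately show ?thesis
    by (simp add: nonneg_fps_intros)
qed

section \<open>Finite Euler identity and the resulting bound\<close>

text \<open>Writing each \<open>1 + q^i\<close> as \<open>(1 - q^(2 * i)) / (1 - q^i)\<close>, the
  even factors up to \<open>2 * N\<close> cancel; the odd denominators and the numerators with
  \<open>i > N\<close> remain.\<close>

lemma odd_fps_mult_prod:
  "odd_fps (N + 1) * (\<Prod>i=N + 1..2 * N + 1. 1 - fps_X ^ (2 * i)) = distinct_fps (2 * N + 1)"
proof (induction N)
  case 0
  have "odd_fps (Suc 0) * (1 - fps_X ^ 2) = odd_fps (Suc 0) * (1 - fps_X) * (1 + fps_X)"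
    by algebra
  also have "odd_fps (Suc 0) * (1 - fps_X) = 1"
    using odd_fps_Suc[of 0] by (simp add: odd_fps_0)
  finally show ?case
    by (simp add: distinct_fps_def)
next
  case (Suc N)
  let ?X = "fps_X :: int fps"
  \<comment> \<open>The part common to both index ranges: the step loses \<open>N + 1\<close> and
    gains \<open>2 * N + 2\<close> and \<open>2 * N + 3\<close>. The lost factor \<open>?b\<close>
    is multiplied back in and cancelled at the end.\<close>
  define P where "P = (\<Prod>i=N + 2..2 * N + 1. 1 - ?X ^ (2 * i))"
  let ?b = "1 - ?X ^ (2 * N + 2)" and ?c = "1 - ?X ^ (2 * N + 3)"
  have P: "(\<Prod>i=N + 1..2 * N + 1. 1 - ?X ^ (2 * i)) = ?b * P"
    unfolding P_def by (subst prod.atLeast_Suc_atMost) simp_all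
  have "{Suc N + 1..2 * Suc N + 1} = insert (2 * N + 3) (insert (2 * N + 2) {N + 2..2 * N + 1})"
    by auto
  then have P': "(\<Prod>i=Suc N + 1..2 * Suc N + 1. 1 - ?X ^ (2 * i))
      = (1 - ?X ^ (2 * (2 * N + 3))) * ((1 - ?X ^ (2 * (2 * N + 2))) * P)"
    by (simp add: P_def)
  have sq: "1 - ?X ^ (2 * k) = (1 - ?X ^ k) * (1 + ?X ^ k)" for k
    by (simp add: power_mult power2_eq_square algebra_simps mult.commute[of 2])
  have c: "odd_fps (Suc N + 1) * ?c = odd_fps (N + 1)"
    using odd_fps_Suc[of "Suc N"] by (simp add: numeral_3_eq_3)
  have "?b * (odd_fps (Suc N + 1) * (\<Prod>i=Suc N + 1..2 * Suc N + 1. 1 - ?X ^ (2 * i)))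
      = (odd_fps (Suc N + 1) * ?c) * (?b * P) * (1 + ?X ^ (2 * N + 3)) * (?b * (1 + ?X ^ (2 * N + 2)))"
    unfolding P' unfolding sq by (simp only: mult_ac)
  also have "\<dots> = distinct_fps (2 * N + 1) * (1 + ?X ^ (2 * N + 3)) * (?b * (1 + ?X ^ (2 * N + 2)))"
    unfolding c P[symmetric] Suc ..
  also have "\<dots> = ?b * (distinct_fps (2 * N + 1) * (1 + ?X ^ (2 * N + 2)) * (1 + ?X ^ (2 * N + 3)))"
    by (simp only: mult_ac)
  also have "distinct_fps (2 * N + 1) * (1 + ?X ^ (2 * N + 2)) * (1 + ?X ^ (2 * N + 3)) = distinct_fps (2 * Suc N + 1)"
    by (simp add: distinct_fps_Suc numeral_3_eq_3)
  finally show ?case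
    using one_minus_fps_X_power_nonzero[of "2 * N + 2"] by (simp only: mult_cancel_left) simp
qed

text \<open>Euler's identity and \<open>nonneg_fps_divide_prod\<close> bound
  \<open>odd_fps (N + 1)\<close> by means of \<open>distinct_fps (2 * N + 1)\<close>. Allowing the
  odd part \<open>2 * N + 3\<close> and forbidding the distinct part \<open>2 * N + 1\<close> only
  widens the difference.\<close>

lemma odd_fps_ge:
  "nonneg_fps (odd_fps (N + 2) - distinct_fps (2 * N) * (1 + (\<Sum>k=N + 1..2 * N + 1. fps_X ^ (2 * k))))"
proof -
  let ?X = "fps_X :: int fps" and ?D = "distinct_fps (2 * N)"
  let ?K = "\<Sum>k=N + 1..2 * N + 1. fps_X ^ (2 * k) :: int fps"
  have D: "nonneg_fps (distinct_fps L)" for L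
    unfolding distinct_fps_def by (intro nonneg_fps_intros)
  let ?I = "(*) 2 ` {N + 1..2 * N + 1}"
  have inj: "inj_on ((*) (2::nat)) A" for A by (simp add: inj_on_def)
  have K: "(\<Sum>i\<in>?I. ?X ^ i) = ?K" and
    P: "odd_fps (N + 1) * (\<Prod>i\<in>?I. 1 - ?X ^ i) = distinct_fps (2 * N + 1)"
    using odd_fps_mult_prod[of N] by (simp_all add: sum.reindex[OF inj] prod.reindex[OF inj])
  have odd1: "nonneg_fps (odd_fps (N + 1) - distinct_fps (2 * N + 1) * (1 + ?K))"
    by (rule nonneg_fps_divide_prod[of ?I "odd_fps (N + 1)", unfolded P K]) (auto intro: D)
  have "nonneg_fps (odd_fps (N + 2))"
    by (simp add: odd_fps_def nonneg_fps_def)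
  then have "nonneg_fps (?X ^ (2 * N + 3) * odd_fps (N + 2) + (odd_fps (N + 1) - distinct_fps (2 * N + 1) * (1 + ?K))
      + ?D * ?X ^ (2 * N + 1) * (1 + ?K))"
    by (intro nonneg_fps_intros odd1 D)
  moreover have "odd_fps (N + 1) = odd_fps (N + 2) * (1 - ?X ^ (2 * N + 3))"
    using odd_fps_Suc[of "N + 1"] by (simp add: numeral_3_eq_3)
  moreover have "distinct_fps (2 * N + 1) = ?D * (1 + ?X ^ (2 * N + 1))"
    by (simp add: distinct_fps_Suc)
  moreover have "?X ^ (2 * N + 3) * odd_fps (N + 2) + (odd_fps (N + 2) * (1 - ?X ^ (2 * N + 3))
      - ?D * (1 + ?X ^ (2 * N + 1)) * (1 + ?K)) + ?D * ?X ^ (2 * N + 1) * (1 + ?K)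
      = odd_fps (N + 2) - ?D * (1 + ?K)"
    by algebra
  ultimately show ?thesis by (simp only:)
qed

lemma pairs_sum_ge:
  "nonneg_fps ((\<Sum>(a, b)\<in>pairs N. fps_X ^ (2 * a + 2 * b)) * (1 + (\<Sum>k=N + 1..2 * N + 1. fps_X ^ (2 * k)))
    - (\<Sum>i<N + 1. (fps_X ^ 4) ^ i) * (\<Sum>j<2 * N + 1. (fps_X ^ 2) ^ j))"
proof -
  let ?V = "\<Sum>(a, b)\<in>pairs N. fps_X ^ (2 * a + 2 * b) :: int fps"
  let ?K = "\<Sum>k=N + 1..2 * N + 1. fps_X ^ (2 * k) :: int fps"
  let ?w = "\<lambda>(a, b). 2 * a + 2 * b :: nat"
  let ?u = "\<lambda>(c, k). ?w c + 2 * k"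
  let ?g = "\<lambda>(i, j). 4 * i + 2 * j :: nat"
  let ?R = "{..<N + 1} \<times> {..<2 * N + 1}"
  let ?R1 = "{(i, j) \<in> ?R. i + j \<le> N}" and ?R2 = "{(i, j) \<in> ?R. N < i + j}"
  let ?h1 = "\<lambda>(i, j). (i, i + j) :: nat \<times> nat"
  \<comment> \<open>With \<open>s = i + j - (N + 1)\<close>, the pair consists of the lower and
    upper halves of \<open>s\<close>, which stay at most \<open>N\<close> because
    \<open>s < 2 * N\<close>. The subtraction is exact on \<open>?R2\<close>; the last component
    recovers \<open>i\<close>, the sum of the pair then \<open>j\<close>.\<close>
  let ?h2 = "\<lambda>(i, j). (((i + j - (N + 1)) div 2, i + j - (N + 1) - (i + j - (N + 1)) div 2), N + 1 + i)"
  have "nonneg_fps ((\<Sum>c\<in>pairs N. fps_X ^ ?w c) - (\<Sum>c\<in>?R1. fps_X ^ ?g c))"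
    by (rule nonneg_fps_diff_sum[where h = ?h1]) (auto simp: pairs_def inj_on_def finite_pairs[unfolded pairs_def])
  moreover have "nonneg_fps ((\<Sum>c\<in>pairs N \<times> {N + 1..2 * N + 1}. fps_X ^ ?u c) - (\<Sum>c\<in>?R2. fps_X ^ ?g c))"
  proof (rule nonneg_fps_diff_sum[where h = ?h2])
    show "inj_on ?h2 ?R2"
    proof (rule inj_onI, clarify)
      fix i j i' j' :: nat
      assume "N < i + j" "N < i' + j'" "N + 1 + i = N + 1 + i'"
        "(i + j - (N + 1)) div 2 = (i' + j' - (N + 1)) div 2"
        "i + j - (N + 1) - (i + j - (N + 1)) div 2 = i' + j' - (N + 1) - (i' + j' - (N + 1)) div 2"
      then show "i = i' \<and> j = j'" by linarith
    qed
    show "?h2 ` ?R2 \<subseteq> pairs N \<times> {N + 1..2 * N + 1}"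
      by (rule image_subsetI) (auto simp: pairs_def)
    show "?u (?h2 c) = ?g c" if "c \<in> ?R2" for c
      using that by auto
  qed simp
  ultimately have "nonneg_fps (((\<Sum>c\<in>pairs N. fps_X ^ ?w c) - (\<Sum>c\<in>?R1. fps_X ^ ?g c))
      + ((\<Sum>c\<in>pairs N \<times> {N + 1..2 * N + 1}. fps_X ^ ?u c) - (\<Sum>c\<in>?R2. fps_X ^ ?g c)))"
    by (rule nonneg_fps_add)
  moreover have "(\<Sum>c\<in>pairs N. fps_X ^ ?w c) = ?V"
    by (simp add: case_prod_unfold)
  moreover have "(\<Sum>c\<in>pairs N \<times> {N + 1..2 * N + 1}. fps_X ^ ?u c) = ?V * ?K"
    unfolding sum_product sum.cartesian_product by (simp add: case_prod_unfold power_add)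
  moreover have "(\<Sum>c\<in>?R1. fps_X ^ ?g c) + (\<Sum>c\<in>?R2. fps_X ^ ?g c)
      = (\<Sum>i<N + 1. (fps_X ^ 4) ^ i) * (\<Sum>j<2 * N + 1. (fps_X ^ 2) ^ j :: int fps)"
  proof -
    have "(\<Sum>c\<in>?R1. fps_X ^ ?g c) + (\<Sum>c\<in>?R2. fps_X ^ ?g c) = (\<Sum>c\<in>?R1 \<union> ?R2. fps_X ^ ?g c :: int fps)"
      by (rule sum.union_disjoint[symmetric]) (auto intro: finite_subset[of _ ?R])
    also have "?R1 \<union> ?R2 = ?R" by auto
    also have "(\<Sum>c\<in>?R. fps_X ^ ?g c)
        = (\<Sum>i<N + 1. (fps_X ^ 4) ^ i) * (\<Sum>j<2 * N + 1. (fps_X ^ 2) ^ j :: int fps)"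
      unfolding sum_product sum.cartesian_product
      by (intro sum.cong refl) (auto simp add: power_add simp flip: power_mult)
    finally show ?thesis .
  qed
  ultimately show ?thesis
    by (simp add: algebra_simps)
qed

theorem mainTheorem3:
  fixes L n :: nat
  assumes "L \<ge> 1"
  shows "(\<Sum>m. (m choose 2) * a\<^sub>2 (nat \<lceil>real L / 2\<rceil>) m n) \<ge> (\<Sum>m. (m choose 2) * b\<^sub>2 L m n)"
proof -
  define M where "M = nat \<lceil>real L / 2\<rceil>"
  have M: "L \<le> 2 * M" "1 \<le> M"
    using assms unfolding M_def by linarith+
  have b: "int (\<Sum>m. (m choose 2) * b\<^sub>2 L m n) \<le> gap_fps 2 (2 * M) $ n"
    by (rule sum_b\<^sub>2_le[OF M(1)])
  show ?thesis
  proof (cases "M = 1")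
    \<comment> \<open>Parts of size at most 2 admit no two gap parts, so the right-hand side
      vanishes; \<open>M - 2\<close> would be truncated here.\<close>
    case True
    then show ?thesis using b by (simp add: gap_fps_2_eq_0)
  next
    case False
    define N where "N = M - 2"
    have N: "M = N + 2" using False M(2) by (simp add: N_def)
    let ?V = "\<Sum>(a, b)\<in>pairs N. fps_X ^ (2 * a + 2 * b) :: int fps"
    let ?K = "\<Sum>k=N + 1..2 * N + 1. fps_X ^ (2 * k) :: int fps"
    let ?R = "(\<Sum>i<N + 1. (fps_X ^ 4) ^ i) * (\<Sum>j<2 * N + 1. (fps_X ^ 2) ^ j :: int fps)"
    let ?D = "distinct_fps (2 * N)"
    have D: "nonneg_fps ?D"
      unfolding distinct_fps_def by (intro nonneg_fps_intros)
    have V: "nonneg_fps ?V"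
      by (simp add: case_prod_unfold nonneg_fps_intros)
    \<comment> \<open>The two comparisons are chained through \<open>?D * (1 + ?K) * ?V\<close>,
      which cancels in the sum.\<close>
    have "nonneg_fps (fps_X ^ 6 * ((odd_fps (N + 2) - ?D * (1 + ?K)) * ?V + ?D * (?V * (1 + ?K) - ?R)))"
      by (intro nonneg_fps_add nonneg_fps_mult nonneg_fps_X_power odd_fps_ge pairs_sum_ge D V)
    also have "fps_X ^ 6 * ((odd_fps (N + 2) - ?D * (1 + ?K)) * ?V + ?D * (?V * (1 + ?K) - ?R))
        = odd_fps (N + 2) * (fps_X ^ 6 * ?V) - fps_X ^ 6 * ?D * ?R"
      by algebra
    also have "fps_X ^ 6 * ?D * ?R = gap_fps 2 (2 * M)"
    proof -
      have "2 * M = 2 * N + 4" by (simp add: N)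
      then show ?thesis by (simp only: gap_fps_2_even)
    qed
    \<comment> \<open>The power 6 is the two offsets 3 of the odd parts \<open>2 * a + 3\<close> and
      \<open>2 * b + 3\<close>.\<close>
    also have "fps_X ^ 6 * ?V = (\<Sum>(a, b)\<in>pairs N. fps_X ^ (2 * a + 3 + (2 * b + 3)))"
      unfolding sum_distrib_left
      by (intro sum.cong) (auto simp: power_add eval_nat_numeral mult_ac)
    finally have "gap_fps 2 (2 * M) $ n
        \<le> (odd_fps (N + 2) * (\<Sum>(a, b)\<in>pairs N. fps_X ^ (2 * a + 3 + (2 * b + 3)))) $ n"
      by (simp add: nonneg_fps_def)
    also have "\<dots> \<le> int (\<Sum>m. (m choose 2) * a\<^sub>2 M m n)"
      using sum_a\<^sub>2_ge[of N n] by (simp only: N)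
    finally have "int (\<Sum>m. (m choose 2) * b\<^sub>2 L m n) \<le> int (\<Sum>m. (m choose 2) * a\<^sub>2 M m n)"
      using b by linarith
    then show ?thesis by (simp only: of_nat_le_iff M_def)
  qed
qed

end
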